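(* We have $$\sum_{n\geq1}c_n(21\text{-}2)t^n=\frac{t+\sum_{j\geq1}\frac{t^{2j+1}(1-t)^{\binom{j-1}{2}-1}\prod_{i=1}^j\left((1-2t)(1-t)^i-(1-t)t^i\right)}{\prod_{i=1}^j\left((1-2t)(1-t)^{2i}-t^i(1-t)^{i+1}+t^{2i+1}\right)}}{1-2t-\sum_{j\geq1}\frac{t^{2j+1}(1-2t)(1-t)^{\binom{j}{2}-1}\prod_{i=1}^j\left((1-2t)(1-t)^i-(1-t)t^i\right)}{\left((1-2t)(1-t)^{j-1}-t^j\right)\prod_{i=1}^j\left((1-2t)(1-t)^{2i}-t^i(1-t)^{i+1}+t^{2i+1}\right)}}.$$
   Context: A Catalan word of length $n\ge 1$ is a sequence $\pi=\pi_1\cdots\pi_n$ of positive integers with $\pi_1=1$ and $\pi_{i+1}\le \pi_i+1$ for $1\le i\le n-1$; $\mathcal{C}_n$ is the set of these. Two sequences of the same length are order-isomorphic if their corresponding pairs of entries stand in the same relation ($<$, $>$ or $=$). A word $\pi$ contains the vincular pattern $xy\text{-}z$ if there are indices $i,j$ with $i+1<j\le n$ such that $\pi_i\pi_{i+1}\pi_j$ is order-isomorphic to $xyz$ (the first two letters must be adjacent in $\pi$); otherwise $\pi$ avoids it. $c_n(\tau)$ denotes the number of members of $\mathcal{C}_n$ avoiding $\tau$. The identity is one of power series in $t$ (rational expressions expanded about $t=0$); $\binom{0}{2}=\binom{1}{2}=0$. *)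

theory Defs
  imports "HOL-Computational_Algebra.Formal_Power_Series"
begin

(* Words are lists, so the letter pi_i of the word w is w ! (i - 1). *)

definition catalan_words :: "nat \<Rightarrow> nat list set" where
  "catalan_words n = {w. length w = n \<and> w \<noteq> [] \<and> (\<forall>x\<in>set w. 1 \<le> x) \<and> w ! 0 = 1 \<and>
     (\<forall>i. i + 1 < n \<longrightarrow> w ! (i + 1) \<le> w ! i + 1)}"

definition order_isomorphic :: "nat list \<Rightarrow> nat list \<Rightarrow> bool" where
  "order_isomorphic u v \<longleftrightarrow> length u = length v \<and>
     (\<forall>a<length u. \<forall>b<length u.
        (u ! a < u ! b \<longleftrightarrow> v ! a < v ! b) \<and>
        (u ! a > u ! b \<longleftrightarrow> v ! a > v ! b) \<and>
        (u ! a = u ! b \<longleftrightarrow> v ! a = v ! b))"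

(* The vincular pattern xy-z. *)
definition contains_vincular :: "nat list \<Rightarrow> nat \<Rightarrow> nat \<Rightarrow> nat \<Rightarrow> bool" where
  "contains_vincular w x y z \<longleftrightarrow>
     (\<exists>i j. i + 1 < j \<and> j < length w \<and> order_isomorphic [w ! i, w ! (i + 1), w ! j] [x, y, z])"

definition catalan_avoid_count :: "nat \<Rightarrow> nat \<Rightarrow> nat \<Rightarrow> nat \<Rightarrow> nat" where
  "catalan_avoid_count x y z n = card {w \<in> catalan_words n. \<not> contains_vincular w x y z}"

lemma finite_catalan_words: "finite (catalan_words n)"
proof (rule finite_subset)
  show "catalan_words n \<subseteq> {w. set w \<subseteq> {..n} \<and> length w = n}"
  proof
    fix w assume w: "w \<in> catalan_words n"
    have "w ! i \<le> i + 1" if "i < n" for i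
      using that
    proof (induction i)
      case 0
      then show ?case using w by (simp add: catalan_words_def)
    next
      case (Suc i)
      have "w ! (i + 1) \<le> w ! i + 1"
        using w Suc.prems by (simp add: catalan_words_def)
      then show ?case using Suc by simp
    qed
    then have "w ! i \<le> n" if "i < n" for i
      using that by (fastforce intro: order_trans)
    then show "w \<in> {w. set w \<subseteq> {..n} \<and> length w = n}"
      using w by (auto simp: catalan_words_def in_set_conv_nth)
  qed
  show "finite {w. set w \<subseteq> {..n} \<and> length w = n}"
    by (rule finite_lists_length_eq) simp
qed

abbreviation t :: "rat fps" where "t \<equiv> fps_X"

(* For j >= 1 every denominator below has constant coefficient 1, so each quotient is the
   expansion about t = 0. The integer power is needed because the exponent of 1 - t can be -1. *)

definition num_term :: "nat \<Rightarrow> rat fps" where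
  "num_term j =
     (t ^ (2 * j + 1) * (1 - t) powi (int ((j - 1) choose 2) - 1) *
        (\<Prod>i = 1..j. (1 - 2 * t) * (1 - t) ^ i - (1 - t) * t ^ i))
     / (\<Prod>i = 1..j. (1 - 2 * t) * (1 - t) ^ (2 * i) - t ^ i * (1 - t) ^ (i + 1) + t ^ (2 * i + 1))"

definition den_term :: "nat \<Rightarrow> rat fps" where
  "den_term j =
     (t ^ (2 * j + 1) * (1 - 2 * t) * (1 - t) powi (int (j choose 2) - 1) *
        (\<Prod>i = 1..j. (1 - 2 * t) * (1 - t) ^ i - (1 - t) * t ^ i))
     / (((1 - 2 * t) * (1 - t) ^ (j - 1) - t ^ j) *
        (\<Prod>i = 1..j. (1 - 2 * t) * (1 - t) ^ (2 * i) - t ^ i * (1 - t) ^ (i + 1) + t ^ (2 * i + 1)))"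

end

theory Submission
  imports Defs
begin

text \<open>
  Put q = t / (1 - t).

  A descent from a letter x in an avoiding word means that x never occurs again; since letters
  climb by at most one, the rest of the word then stays below x.  Splitting a word into maximal
  weakly increasing blocks, the blocks therefore have strictly decreasing top letters
  m > p > p' > ..., the first block climbs through 1, ..., m, and a later block with top p starts at
  any letter of 1, ..., p.  A block climbs by single steps and repeats each letter of its range any
  number of times, so each letter of the range contributes a factor q, and
    C(t) = \<Sum>m\<ge>1. q^m \<Prod>p=1..m-1 (1 + q + ... + q^p) = \<Sum>m\<ge>1. z^m (q;q)_m,  z = q / (1 - q).

  The stated quotient becomes transparent in q.  With a_i = 1 - q - q^i, the factors of the
  numerator products are a_i and those of the denominator products are a_i + q^(2i+1), up to
  powers of 1 - t.  The polynomial a_i + q^(2i+1) factors as (1 - q^i) a_(i+1).  Hence the ratio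
  P_j of the two products collapses to a_1 / (a_(j+1) (q;q)_j), the numerator is
  (1 - t) \<Sum>j\<ge>0. q^(2j+1) P_j, and the denominator telescopes to (1 - 2t) lim P_j.

  What remains is
    \<Sum>m\<ge>1. z^m (q;q)_m = (q;q)_\<infinity> \<Sum>j\<ge>0. q^(2j+1) / (a_(j+1) (q;q)_j),
  which follows from Euler's expansion (q;q)_m = (q;q)_\<infinity> \<Sum>j. q^((m+1)j) / (q;q)_j by summing a
  geometric series in m for each j.  All infinite sums and products are cut off at J, and the
  identities are proved modulo q^(J+1) for every J: the lemmas \<open>truncated_euler\<close>,
  \<open>q_series_transformation\<close> and \<open>truncated_quotient_identity\<close>.  The combinatorial half is
  \<open>extension_gf_formula\<close>.
\<close>

unbundle fps_syntax

section \<open>Avoiding words, letter by letter\<close>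

text \<open>
  The constant keeps the numeral 1 of the pattern out of reach of the simplifier, which would
  rewrite it to a successor term.
\<close>
definition contains_212 :: "nat list \<Rightarrow> bool" where
  "contains_212 w \<longleftrightarrow> contains_vincular w 2 1 2"

lemma contains_212_iff:
  "contains_212 w \<longleftrightarrow>
     (\<exists>i j. i + 1 < j \<and> j < length w \<and> w ! (i + 1) < w ! i \<and> w ! j = w ! i)"
proof -
  have "order_isomorphic [a, b, c] [2, 1, 2] \<longleftrightarrow> b < a \<and> c = a" for a b c
    by (auto simp: order_isomorphic_def All_less_Suc2)
  then show ?thesis
    by (simp add: contains_212_def contains_vincular_def)
qed

lemma contains_212_Cons:
  "contains_212 (x # y # ys) \<longleftrightarrow>
     y < x \<and> x \<in> set ys \<or> contains_212 (y # ys)"  (is "?L \<longleftrightarrow> ?R")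
proof
  assume ?L
  then obtain i j where ij: "i + 1 < j" "j < length (x # y # ys)"
      "(x # y # ys) ! (i + 1) < (x # y # ys) ! i" "(x # y # ys) ! j = (x # y # ys) ! i"
    unfolding contains_212_iff by blast
  then obtain k where j: "j = Suc (Suc k)"
    by (metis One_nat_def add_Suc_right less_imp_Suc_add add.commute add_Suc)
  show ?R
  proof (cases i)
    case 0
    then show ?thesis using ij j by (auto simp: in_set_conv_nth)
  next
    case (Suc l)
    have "contains_212 (y # ys)"
      unfolding contains_212_iff
      by (rule exI[of _ l], rule exI[of _ "Suc k"]) (use ij j Suc in auto)
    then show ?thesis ..
  qed
next
  assume ?R
  then show ?L
  proof
    assume *: "y < x \<and> x \<in> set ys"
    then obtain k where "k < length ys" "ys ! k = x"
      by (auto simp: in_set_conv_nth)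
    with * show ?L
      unfolding contains_212_iff
      by (intro exI[of _ 0] exI[of _ "Suc (Suc k)"]) auto
  next
    assume "contains_212 (y # ys)"
    then obtain i j where "i + 1 < j" "j < length (y # ys)"
      "(y # ys) ! (i + 1) < (y # ys) ! i" "(y # ys) ! j = (y # ys) ! i"
      unfolding contains_212_iff by blast
    then show ?L
      unfolding contains_212_iff by (intro exI[of _ "Suc i"] exI[of _ "Suc j"]) auto
  qed
qed

abbreviation catalan_step :: "nat \<Rightarrow> nat \<Rightarrow> bool" where
  "catalan_step a b \<equiv> b \<le> a + 1"

text \<open>
  A word that climbs by at most one cannot pass the level x without using the letter x.
\<close>
lemma catalan_steps_stay_below:
  assumes "successively catalan_step (y # ys)" and "y < x" and "x \<notin> set ys"
  shows "\<forall>v\<in>set ys. v < x"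
  using assms
proof (induction ys arbitrary: y)
  case Nil
  then show ?case by simp
next
  case (Cons v ys)
  then have "v < x" by auto
  then show ?case using Cons by auto
qed

text \<open>
  The bound B on the new letters records the past: after a descent from x only letters below x
  may follow.
\<close>
definition extensions :: "nat \<Rightarrow> nat \<Rightarrow> nat \<Rightarrow> nat list set" where
  "extensions n x B = {ys. length ys = n \<and> set ys \<subseteq> {1..B} \<and>
     successively catalan_step (x # ys) \<and> \<not> contains_212 (x # ys)}"

lemma finite_extensions: "finite (extensions n x B)"
  by (rule finite_subset[OF _ finite_lists_length_eq[of "{1..B}" n]])
     (auto simp: extensions_def)

lemma extensions_0: "extensions 0 x B = {[]}"
  by (auto simp: extensions_def contains_212_iff)

text \<open>
  Steps up and level steps keep the bound.  A step down from x makes x forbidden, which by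
  \<open>catalan_steps_stay_below\<close> amounts to lowering the bound to x - 1.
\<close>
lemma extensions_Suc:
  assumes "x \<le> B"
  shows "extensions (Suc n) x B =
    (\<Union>y\<in>{1..min (x + 1) B}. (#) y ` extensions n y (if y < x then x - 1 else B))"
proof (rule set_eqI)
  fix w
  show "w \<in> extensions (Suc n) x B \<longleftrightarrow>
      w \<in> (\<Union>y\<in>{1..min (x + 1) B}. (#) y ` extensions n y (if y < x then x - 1 else B))"
  proof (cases w)
    case Nil
    then show ?thesis by (auto simp: extensions_def)
  next
    case (Cons y ys)
    have below: "set ys \<subseteq> {1..x - 1} \<longleftrightarrow> set ys \<subseteq> {1..B} \<and> x \<notin> set ys"
      if "successively catalan_step (y # ys)" "y < x"
      using catalan_steps_stay_below[OF that] that(2) assms by fastforce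
    show ?thesis
    proof (cases "y < x")
      case True
      have "w \<in> extensions (Suc n) x B \<longleftrightarrow>
          1 \<le> y \<and> ys \<in> extensions n y (x - 1)"
        using below[OF _ True] True assms
        by (auto simp: Cons extensions_def contains_212_Cons)
      then show ?thesis using True assms by (auto simp: Cons)
    next
      case False
      then show ?thesis
        using assms by (auto simp: Cons extensions_def contains_212_Cons)
    qed
  qed
qed

lemma card_extensions_Suc:
  assumes "x \<le> B"
  shows "card (extensions (Suc n) x B) =
    (\<Sum>y = 1..min (x + 1) B. card (extensions n y (if y < x then x - 1 else B)))"
  unfolding extensions_Suc[OF assms]
  by (subst card_UN_disjoint)
     (auto simp: finite_extensions card_image)

text \<open>
  The i-th letter of a Catalan word is at most i, so any bound at least the length is harmless.
\<close>
lemma catalan_avoid_count_eq_card_extensions: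
  assumes "Suc n \<le> B"
  shows "catalan_avoid_count 2 1 2 (Suc n) = card (extensions n 1 B)"
proof -
  have "{w \<in> catalan_words (Suc n). \<not> contains_212 w} = (#) 1 ` extensions n 1 B"
  proof (rule set_eqI)
    fix w :: "nat list"
    show "w \<in> {w \<in> catalan_words (Suc n). \<not> contains_212 w} \<longleftrightarrow>
        w \<in> (#) 1 ` extensions n 1 B"
    proof (cases w)
      case Nil
      then show ?thesis by (auto simp: catalan_words_def)
    next
      case (Cons x ys)
      have le: "(1 # ys) ! i \<le> Suc i"
        if "successively catalan_step (1 # ys)" "i < Suc (length ys)" for i
        using that(2)
      proof (induction i)
        case (Suc i)
        then show ?case
          using successively_nth[OF that(1), of i] by fastforce
      qed simp
      have ub: "set ys \<subseteq> {1..B}" if "successively catalan_step (1 # ys)" "length ys = n"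
          "\<forall>v\<in>set ys. 1 \<le> v"
      proof
        fix v assume v: "v \<in> set ys"
        then obtain i where i: "i < length ys" "ys ! i = v"
          by (auto simp: in_set_conv_nth)
        then have "v \<le> Suc (Suc i)" using le[OF that(1), of "Suc i"] by simp
        then show "v \<in> {1..B}" using v i that assms by auto
      qed
      have "w \<in> {w \<in> catalan_words (Suc n). \<not> contains_212 w} \<longleftrightarrow>
          x = 1 \<and> length ys = n \<and> (\<forall>v\<in>set ys. 1 \<le> v) \<and>
          successively catalan_step (1 # ys) \<and> \<not> contains_212 (1 # ys)"
        unfolding Cons catalan_words_def successively_conv_nth by auto
      also have "\<dots> \<longleftrightarrow> w \<in> (#) 1 ` extensions n 1 B"
        using ub by (auto simp: Cons extensions_def)
      finally show ?thesis .
    qed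
  qed
  then show ?thesis
    by (simp add: catalan_avoid_count_def card_image contains_212_def)
qed

section \<open>The generating function as a sum over the largest letter\<close>

text \<open>
  The variable q = t + t^2 + ... enumerates the non-empty runs of one repeated letter.
\<close>
definition run_var :: "rat fps" where
  "run_var = t * inverse (1 - t)"

lemma one_minus_t_inverse: "(1 - t) * inverse (1 - t) = 1"
  by (intro inverse_mult_eq_1') simp

lemma one_minus_t_power_inverse: "(1 - t) ^ n * inverse (1 - t) ^ n = 1"
  by (simp only: power_mult_distrib[symmetric] one_minus_t_inverse power_one)

lemma one_minus_t_run_var: "(1 - t) * run_var = t"
  using one_minus_t_inverse by (simp add: run_var_def mult.left_commute)

lemma run_var_nth_0: "run_var $ 0 = 0"
  by (simp add: run_var_def)

text \<open>
  The factor for i chooses, for the peak i, whether it is absent (k = 0) or is the top of an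
  increasing block that runs through k letters.  For i = 0 the factor is 1.
\<close>
definition level_product :: "'a::field fps \<Rightarrow> nat \<Rightarrow> 'a fps" where
  "level_product q p = (\<Prod>i<p. \<Sum>k\<le>i. q ^ k)"

lemma level_product_Suc: "level_product q (Suc p) = level_product q p * (\<Sum>k\<le>p. q ^ k)"
  by (simp add: level_product_def)

text \<open>
  What can follow a descent from x, sorted by the letter y after the descent and the next peak p.
  Adding the level x to the right-hand side adds the block choices for p = x, which is the
  recursion of the product.
\<close>
lemma level_product_recurrence:
  fixes q :: "'a::field fps"
  assumes "1 \<le> x"
  shows "level_product q x = 1 + q * (\<Sum>y = 1..<x. \<Sum>p = y..<x. q ^ (p - y) * level_product q p)"
  using assms
proof (induction x rule: nat_induct_at_least)
  case base
  then show ?case by (simp add: level_product_def)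
next
  case (Suc x)
  let ?A = "level_product q"
  have geometric: "(\<Sum>y = 1..<Suc x. q ^ (x - y)) = (\<Sum>k<x. q ^ k)"
    by (rule sum.reindex_bij_witness[of _ "\<lambda>k. x - k" "\<lambda>y. x - y"]) auto
  have "(\<Sum>k\<le>x. q ^ k) = 1 + q * (\<Sum>k<x. q ^ k)"
    by (simp only: lessThan_Suc_atMost[symmetric] sum.lessThan_Suc_shift power_0 power_Suc
        sum_distrib_left)
  then have "?A (Suc x) = ?A x + q * (?A x * (\<Sum>y = 1..<Suc x. q ^ (x - y)))"
    by (simp only: level_product_Suc geometric) (simp add: algebra_simps)
  also have "\<dots> = 1 + q * ((\<Sum>y = 1..<x. \<Sum>p = y..<x. q ^ (p - y) * ?A p) +
      (\<Sum>y = 1..<Suc x. q ^ (x - y) * ?A x))"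
  proof -
    have "?A x * (\<Sum>y = 1..<Suc x. q ^ (x - y)) = (\<Sum>y = 1..<Suc x. q ^ (x - y) * ?A x)"
      by (simp only: sum_distrib_right mult.commute[of "?A x"])
    then show ?thesis by (subst (1) Suc.IH) (simp only: distrib_left add.assoc)
  qed
  also have "(\<Sum>y = 1..<x. \<Sum>p = y..<x. q ^ (p - y) * ?A p) =
      (\<Sum>y = 1..<Suc x. \<Sum>p = y..<x. q ^ (p - y) * ?A p)"
    using Suc.hyps by simp
  also have "(\<Sum>y = 1..<Suc x. \<Sum>p = y..<x. q ^ (p - y) * ?A p) +
      (\<Sum>y = 1..<Suc x. q ^ (x - y) * ?A x) =
      (\<Sum>y = 1..<Suc x. \<Sum>p = y..<Suc x. q ^ (p - y) * ?A p)"
    unfolding sum.distrib[symmetric] by (intro sum.cong refl) simp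
  finally show ?case .
qed

definition extension_gf :: "nat \<Rightarrow> nat \<Rightarrow> rat fps" where
  "extension_gf x B = Abs_fps (\<lambda>n. of_nat (card (extensions n x B)))"

lemma extension_gf_equation:
  assumes "x \<le> B"
  shows "extension_gf x B =
    1 + t * (\<Sum>y = 1..min (x + 1) B. extension_gf y (if y < x then x - 1 else B))"
proof (rule fps_ext)
  fix n
  show "extension_gf x B $ n =
    (1 + t * (\<Sum>y = 1..min (x + 1) B. extension_gf y (if y < x then x - 1 else B))) $ n"
    by (cases n)
       (simp_all add: extension_gf_def extensions_0 card_extensions_Suc[OF assms] fps_sum_nth
          del: min_def)
qed

text \<open>
  From x the word climbs to a peak p, each new letter opening a run, and then either ends or
  descends; \<open>level_product_recurrence\<close> evaluates everything below the peak.  The recursion over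
  the next letter lowers the bound or raises the letter, so it is solved by induction on B and
  then on B - x.
\<close>
lemma extension_gf_formula:
  assumes "1 \<le> x" "x \<le> B"
  shows "(1 - t) * extension_gf x B =
    (\<Sum>p = x..B. run_var ^ (p - x) * level_product run_var p)"
  using assms
proof (induction B arbitrary: x rule: less_induct)
  case (less B)
  note shorter_bound = less.IH
  let ?q = run_var
  let ?A = "level_product run_var"
  have tq: "t * f = ?q * ((1 - t) * f)" for f
    by (simp only: one_minus_t_run_var mult.assoc[symmetric] mult.commute[of run_var "1 - t"])
  show ?case
    using less.prems
  proof (induction "B - x" arbitrary: x rule: less_induct)
    case (less x)
    \<comment> \<open>R collects the descents from x and U the ascent, which is absent at the bound.\<close>
    define R where "R = (\<Sum>y = 1..<x. extension_gf y (x - 1))"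
    define U where "U = (if x < B then extension_gf (x + 1) B else 0)"
    have "(\<Sum>y = 1..min (x + 1) B. extension_gf y (if y < x then x - 1 else B)) =
        R + extension_gf x B + U"
    proof -
      have "{1..min (x + 1) B} = (if x < B then {x + 1} else {}) \<union> insert x {1..<x}"
        using less.prems by auto
      then show ?thesis by (simp add: R_def U_def)
    qed
    then have gf: "extension_gf x B = 1 + t * (R + extension_gf x B + U)"
      using extension_gf_equation[OF less.prems(2)] by simp
    have "(1 - t) * extension_gf x B = extension_gf x B - t * extension_gf x B"
      by (simp add: left_diff_distrib)
    also have "\<dots> = 1 + t * R + t * U"
      by (subst (1) gf) (simp add: distrib_left)
    also have "t * R = ?q * (\<Sum>y = 1..<x. \<Sum>p = y..<x. ?q ^ (p - y) * ?A p)"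
    proof -
      have "(1 - t) * extension_gf y (x - 1) = (\<Sum>p = y..<x. ?q ^ (p - y) * ?A p)"
        if "y \<in> {1..<x}" for y
      proof -
        have "{y..x - 1} = {y..<x}" using that by auto
        then show ?thesis
          using shorter_bound[of "x - 1" y] that less.prems by auto
      qed
      then show ?thesis by (simp add: tq R_def sum_distrib_left)
    qed
    also have "1 + \<dots> = ?A x"
      by (rule level_product_recurrence[OF less.prems(1), symmetric])
    also have "t * U = (\<Sum>p = Suc x..B. ?q ^ (p - x) * ?A p)"
    proof (cases "x < B")
      case True
      have "(1 - t) * U = (\<Sum>p = Suc x..B. ?q ^ (p - Suc x) * ?A p)"
        using less.hyps[of "Suc x"] True by (simp add: U_def)
      then have "t * U = (\<Sum>p = Suc x..B. ?q ^ Suc (p - Suc x) * ?A p)"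
        by (simp add: tq sum_distrib_left mult.assoc)
      also have "\<dots> = (\<Sum>p = Suc x..B. ?q ^ (p - x) * ?A p)"
        by (intro sum.cong refl) (simp add: Suc_diff_Suc del: power_Suc)
      finally show ?thesis .
    next
      case False
      then show ?thesis by (simp add: U_def)
    qed
    also have "?A x + \<dots> = (\<Sum>p = x..B. ?q ^ (p - x) * ?A p)"
      using less.prems by (simp add: sum.atLeast_Suc_atMost)
    finally show ?case .
  qed
qed

text \<open>The finite q-Pochhammer symbol (q;q)_m.\<close>
definition q_pochhammer :: "'a::field fps \<Rightarrow> nat \<Rightarrow> 'a fps" where
  "q_pochhammer q m = (\<Prod>i = 1..m. 1 - q ^ i)"

lemma q_pochhammer_0 [simp]: "q_pochhammer q 0 = 1"
  by (simp add: q_pochhammer_def)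

lemma q_pochhammer_Suc: "q_pochhammer q (Suc m) = (1 - q ^ Suc m) * q_pochhammer q m"
  by (simp add: q_pochhammer_def mult.commute)

lemma q_pochhammer_nth_0:
  assumes "q $ 0 = 0"
  shows "q_pochhammer q m $ 0 = 1"
  by (induction m) (simp_all add: q_pochhammer_Suc assms)

lemma level_product_eq_q_pochhammer:
  fixes q :: "'a::field fps"
  assumes q0: "q $ 0 = 0"
  shows "q ^ m * level_product q m = (q * inverse (1 - q)) ^ m * q_pochhammer q m"
proof -
  have "q_pochhammer q m = (1 - q) ^ m * level_product q m"
  proof (induction m)
    case 0
    then show ?case by (simp add: level_product_def)
  next
    case (Suc m)
    have "1 - q ^ Suc m = (1 - q) * (\<Sum>k\<le>m. q ^ k)"
      using one_diff_power_eq[of q "Suc m"] by (simp only: lessThan_Suc_atMost)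
    then show ?case
      unfolding q_pochhammer_Suc level_product_Suc Suc.IH by (simp only: power_Suc mult_ac)
  qed
  moreover have "inverse (1 - q) * (1 - q) = 1"
    by (intro inverse_mult_eq_1) (simp add: q0)
  then have "(inverse (1 - q)) ^ m * (1 - q) ^ m = 1"
    by (simp only: power_mult_distrib[symmetric] power_one)
  ultimately show ?thesis
    by (simp add: power_mult_distrib mult.assoc mult.assoc[of "inverse (1 - q) ^ m", symmetric])
qed

definition avoider_gf :: "rat fps" where
  "avoider_gf = Abs_fps (\<lambda>n. if n \<ge> 1 then of_nat (catalan_avoid_count 2 1 2 n) else 0)"

lemma fps_X_power_dvd_iff:
  fixes f :: "'a::comm_ring_1 fps"
  shows "fps_X ^ n dvd f \<longleftrightarrow> (\<forall>k<n. f $ k = 0)"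
proof
  assume "fps_X ^ n dvd f"
  then show "\<forall>k<n. f $ k = 0"
    by (auto simp: dvd_def fps_X_power_mult_nth)
next
  assume "\<forall>k<n. f $ k = 0"
  then have "f = fps_X ^ n * fps_shift n f"
    by (intro fps_ext) (simp add: fps_X_power_mult_nth)
  then show "fps_X ^ n dvd f" by (rule dvdI)
qed

text \<open>
  The summation index m is the largest letter, which is the top of the first increasing block.
  Divisibility by a power of t expresses agreement of all lower coefficients.
\<close>
lemma avoider_gf_by_max_letter:
  assumes "1 \<le> B"
  shows "t ^ (B + 1) dvd avoider_gf -
    (\<Sum>m = 1..B. (run_var * inverse (1 - run_var)) ^ m * q_pochhammer run_var m)"
proof -
  have "t * extension_gf 1 B = run_var * ((1 - t) * extension_gf 1 B)"
    by (simp only: one_minus_t_run_var mult.assoc[symmetric] mult.commute[of run_var "1 - t"])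
  also have "\<dots> = (\<Sum>m = 1..B. run_var ^ m * level_product run_var m)"
    unfolding extension_gf_formula[OF order_refl assms] sum_distrib_left
  proof (intro sum.cong refl)
    fix m assume "m \<in> {1..B}"
    then have "run_var ^ m = run_var * run_var ^ (m - 1)"
      by (cases m) simp_all
    then show "run_var * (run_var ^ (m - 1) * level_product run_var m) =
        run_var ^ m * level_product run_var m"
      by (simp only: mult.assoc)
  qed
  finally have *: "(\<Sum>m = 1..B. (run_var * inverse (1 - run_var)) ^ m * q_pochhammer run_var m) =
      t * extension_gf 1 B"
    by (simp only: level_product_eq_q_pochhammer[OF run_var_nth_0])
  show ?thesis
    unfolding * fps_X_power_dvd_iff
  proof (intro allI impI)
    fix k assume "k < B + 1"
    then show "(avoider_gf - t * extension_gf 1 B) $ k = 0"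
      using catalan_avoid_count_eq_card_extensions[of "k - 1" B]
      by (cases k) (simp_all add: avoider_gf_def extension_gf_def)
  qed
qed

section \<open>A truncated q-series transformation\<close>

lemma q_pochhammer_inverse:
  assumes "q $ 0 = 0"
  shows "q_pochhammer q m * inverse (q_pochhammer q m) = 1"
  using q_pochhammer_nth_0[OF assms, of m] by (intro inverse_mult_eq_1') simp

lemma inverse_q_pochhammer_Suc:
  assumes "q $ 0 = 0"
  shows "inverse (q_pochhammer q m) = (1 - q ^ Suc m) * inverse (q_pochhammer q (Suc m))"
proof -
  have "(1 - q ^ Suc m) * inverse (1 - q ^ Suc m) = 1"
    by (intro inverse_mult_eq_1') (simp add: assms)
  then show ?thesis
    by (simp only: q_pochhammer_Suc fps_inverse_mult mult.assoc[symmetric] mult_1_left)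
qed

text \<open>
  The q-difference equation (1 - y) e(y) = e(q y) of Euler's series e(y) = \<Sum>j. y^j / (q;q)_j, with the
  error made by stopping at J.
\<close>
lemma truncated_euler_functional_equation:
  fixes q y :: "'a::field fps"
  assumes q0: "q $ 0 = 0"
  shows "(1 - y) * (\<Sum>j\<le>J. y ^ j * inverse (q_pochhammer q j)) =
    (\<Sum>j\<le>J. (q * y) ^ j * inverse (q_pochhammer q j)) - y ^ (J + 1) * inverse (q_pochhammer q J)"
proof (induction J)
  case 0
  then show ?case by simp
next
  case (Suc J)
  then show ?case
    by (simp add: distrib_left inverse_q_pochhammer_Suc[OF q0, of J] power_mult_distrib)
       (simp add: algebra_simps)
qed

text \<open>
  Without truncation this is (q;q)_\<infinity> e(q^(m+1)) = (q;q)_m.  The functional equation at y = 1 starts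
  the induction and at y = q^(m+1) performs the step.
\<close>
lemma truncated_euler:
  fixes q :: "'a::field fps"
  assumes q0: "q $ 0 = 0"
  shows "q ^ (J + 1) dvd
    q_pochhammer q J * (\<Sum>j\<le>J. (q ^ (m + 1)) ^ j * inverse (q_pochhammer q j)) - q_pochhammer q m"
proof (induction m)
  case 0
  have "(\<Sum>j\<le>J. q ^ j * inverse (q_pochhammer q j)) = inverse (q_pochhammer q J)"
    using truncated_euler_functional_equation[OF q0, of 1 J] by simp
  then show ?case by (simp add: q_pochhammer_inverse[OF q0])
next
  case (Suc m)
  define e where "e y = q_pochhammer q J * (\<Sum>j\<le>J. y ^ j * inverse (q_pochhammer q j))" for y
  have fe: "e (q * y) = (1 - y) * e y + y ^ (J + 1)" for y
  proof -
    have "(1 - y) * e y = q_pochhammer q J *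
        ((1 - y) * (\<Sum>j\<le>J. y ^ j * inverse (q_pochhammer q j)))"
      by (simp add: e_def algebra_simps)
    also have "\<dots> = e (q * y) - y ^ (J + 1) * (q_pochhammer q J * inverse (q_pochhammer q J))"
      unfolding truncated_euler_functional_equation[OF q0] e_def by (simp add: algebra_simps)
    finally show ?thesis by (simp add: q_pochhammer_inverse[OF q0])
  qed
  have "e (q ^ (Suc m + 1)) = (1 - q ^ (m + 1)) * e (q ^ (m + 1)) + (q ^ (m + 1)) ^ (J + 1)"
    using fe[of "q ^ (m + 1)"] by (simp only: power_Suc[symmetric] add_Suc)
  moreover have "q_pochhammer q (Suc m) = (1 - q ^ (m + 1)) * q_pochhammer q m"
    by (simp add: q_pochhammer_Suc)
  ultimately have "e (q ^ (Suc m + 1)) - q_pochhammer q (Suc m) =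
      (1 - q ^ (m + 1)) * (e (q ^ (m + 1)) - q_pochhammer q m) + (q ^ (m + 1)) ^ (J + 1)"
    by (simp only: right_diff_distrib) simp
  also have "q ^ (J + 1) dvd \<dots>"
    using Suc.IH by (intro dvd_add dvd_mult dvd_power_same) (simp_all add: e_def)
  finally show ?case by (simp only: e_def)
qed

text \<open>
  With z = q / (1 - q), the quotient q^(2j+1) / (1 - q - q^(j+1)) equals q^j (z q^j) / (1 - z q^j).
  Expanding it as a geometric series in m and exchanging the sums leaves Euler's series at q^(m+1).
\<close>
lemma q_series_transformation:
  fixes q :: "'a::field fps"
  assumes q0: "q $ 0 = 0"
  shows "q ^ (J + 1) dvd (\<Sum>m = 1..J. (q * inverse (1 - q)) ^ m * q_pochhammer q m) -
    q_pochhammer q J *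
      (\<Sum>j\<le>J. q ^ (2 * j + 1) * inverse (1 - q - q ^ (j + 1)) * inverse (q_pochhammer q j))"
proof -
  define z where "z = q * inverse (1 - q)"
  have inv1: "(1 - q) * inverse (1 - q) = 1"
    by (intro inverse_mult_eq_1') (simp add: q0)
  have zq: "(1 - q) * z = q"
    using inv1 by (simp add: z_def mult.left_commute)
  have geometric: "q ^ (J + 1) dvd
      q ^ j * (\<Sum>m = 1..J. (z * q ^ j) ^ m) - q ^ (2 * j + 1) * inverse (1 - q - q ^ (j + 1))" for j
  proof -
    define r where "r = z * q ^ j"
    define a where "a = 1 - q - q ^ (j + 1)"
    have a: "a * inverse a = 1"
      by (intro inverse_mult_eq_1') (simp add: a_def q0)
    have ar: "a = (1 - q) * (1 - r)"
      using zq by (simp add: a_def r_def right_diff_distrib mult.assoc[symmetric])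
    have sum: "(1 - r) * (\<Sum>m = 1..J. r ^ m) = r - r ^ (J + 1)"
      by (induction J) (simp_all add: distrib_left, simp add: algebra_simps)
    have qr: "q ^ (2 * j + 1) = q ^ j * ((1 - q) * r)"
      using zq by (simp add: r_def mult.assoc[symmetric] power_add mult_2)
    have "a * (q ^ j * (\<Sum>m = 1..J. r ^ m)) = q ^ j * ((1 - q) * ((1 - r) * (\<Sum>m = 1..J. r ^ m)))"
      by (simp add: ar algebra_simps)
    also have "\<dots> = q ^ (2 * j + 1) - q ^ j * (1 - q) * r ^ (J + 1)"
      unfolding sum qr by (simp add: algebra_simps)
    finally have *: "a * (q ^ j * (\<Sum>m = 1..J. r ^ m)) - q ^ (2 * j + 1) =
        - (q ^ j * (1 - q) * r ^ (J + 1))"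
      by simp
    have "q ^ j * (\<Sum>m = 1..J. r ^ m) - q ^ (2 * j + 1) * inverse a =
        inverse a * (a * (q ^ j * (\<Sum>m = 1..J. r ^ m)) - q ^ (2 * j + 1))"
      using a by (simp add: right_diff_distrib mult.assoc[symmetric])
        (simp add: mult.commute)
    also have "\<dots> = - (inverse a * q ^ j * (1 - q)) * r ^ (J + 1)"
      unfolding * by (simp add: algebra_simps)
    finally have "q ^ j * (\<Sum>m = 1..J. r ^ m) - q ^ (2 * j + 1) * inverse a =
        - (inverse a * q ^ j * (1 - q)) * r ^ (J + 1)" .
    moreover have "q ^ (J + 1) dvd r ^ (J + 1)"
      by (intro dvd_power_same) (simp add: r_def z_def)
    ultimately have "q ^ (J + 1) dvd
        q ^ j * (\<Sum>m = 1..J. r ^ m) - q ^ (2 * j + 1) * inverse a"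
      by (simp only: dvd_mult)
    then show ?thesis by (simp only: r_def a_def)
  qed
  \<comment> \<open>S1 arises from the left-hand sum by Euler's expansion, and from the right-hand sum S2 by
    geometric expansion.\<close>
  define S1 where "S1 = q_pochhammer q J *
    (\<Sum>j\<le>J. (q ^ j * (\<Sum>m = 1..J. (z * q ^ j) ^ m)) * inverse (q_pochhammer q j))"
  have "S1 = (\<Sum>m = 1..J. z ^ m *
      (q_pochhammer q J * (\<Sum>j\<le>J. (q ^ (m + 1)) ^ j * inverse (q_pochhammer q j))))"
  proof -
    have "S1 = (\<Sum>j\<le>J. \<Sum>m = 1..J. z ^ m *
        (q_pochhammer q J * ((q ^ (m + 1)) ^ j * inverse (q_pochhammer q j))))"
      unfolding S1_def sum_distrib_left sum_distrib_right
      by (intro sum.cong refl)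
         (simp add: power_mult_distrib power_mult[symmetric] power_add mult_ac)
    also have "\<dots> = (\<Sum>m = 1..J. \<Sum>j\<le>J. z ^ m *
        (q_pochhammer q J * ((q ^ (m + 1)) ^ j * inverse (q_pochhammer q j))))"
      by (rule sum.swap)
    finally show ?thesis by (simp only: sum_distrib_left)
  qed
  then have "S1 - (\<Sum>m = 1..J. z ^ m * q_pochhammer q m) = (\<Sum>m = 1..J. z ^ m *
      (q_pochhammer q J * (\<Sum>j\<le>J. (q ^ (m + 1)) ^ j * inverse (q_pochhammer q j))
        - q_pochhammer q m))"
    by (simp only: right_diff_distrib sum_subtractf)
  also have "q ^ (J + 1) dvd \<dots>"
    by (intro dvd_sum dvd_mult truncated_euler[OF q0])
  finally have 1: "q ^ (J + 1) dvd S1 - (\<Sum>m = 1..J. z ^ m * q_pochhammer q m)" .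
  define S2 where "S2 = q_pochhammer q J *
    (\<Sum>j\<le>J. q ^ (2 * j + 1) * inverse (1 - q - q ^ (j + 1)) * inverse (q_pochhammer q j))"
  have "S1 - S2 = q_pochhammer q J * (\<Sum>j\<le>J.
      (q ^ j * (\<Sum>m = 1..J. (z * q ^ j) ^ m) - q ^ (2 * j + 1) * inverse (1 - q - q ^ (j + 1)))
        * inverse (q_pochhammer q j))"
    unfolding S1_def S2_def
    by (simp only: right_diff_distrib left_diff_distrib sum_subtractf)
  also have "q ^ (J + 1) dvd \<dots>"
    by (intro dvd_mult dvd_sum dvd_mult2 geometric)
  finally have "q ^ (J + 1) dvd S1 - S2" .
  from dvd_diff[OF this 1] show ?thesis
    by (simp add: S2_def z_def)
qed

text \<open>
  The quotient of the two products in the j-th numerator term, freed of its powers of 1 - t.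
\<close>
definition partial_ratio :: "'a::field fps \<Rightarrow> nat \<Rightarrow> 'a fps" where
  "partial_ratio q j =
     (\<Prod>i = 1..j. (1 - q - q ^ i) * inverse (1 - q - q ^ i + q ^ (2 * i + 1)))"

text \<open>
  As a polynomial in y = q^i the left-hand side is the quadratic q y^2 - y + (1 - q) with root
  y = 1.  This factorisation makes the products collapse.
\<close>
lemma denominator_factorisation:
  fixes q :: "'a::comm_ring_1"
  shows "1 - q - q ^ i + q ^ (2 * i + 1) = (1 - q ^ i) * (1 - q - q ^ (i + 1))"
proof -
  have "q ^ (2 * i + 1) = q * (q ^ i * q ^ i)"
    by (simp add: mult_2 power_add)
  then show ?thesis by (simp add: algebra_simps)
qed

lemma partial_ratio_closed_form:
  fixes q :: "'a::field fps"
  assumes q0: "q $ 0 = 0"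
  shows "partial_ratio q j =
    (1 - 2 * q) * inverse (1 - q - q ^ (j + 1)) * inverse (q_pochhammer q j)"
proof (induction j)
  case 0
  have "(1 - 2 * q) * inverse (1 - 2 * q) = 1"
    by (intro inverse_mult_eq_1') (simp add: q0)
  then show ?case by (simp add: partial_ratio_def algebra_simps)
next
  case (Suc j)
  define a where "a = 1 - q - q ^ (j + 1)"
  have a: "inverse a * a = 1"
    by (intro inverse_mult_eq_1) (simp add: a_def q0)
  have "partial_ratio q (Suc j) = partial_ratio q j *
      (a * inverse (1 - q - q ^ Suc j + q ^ (2 * Suc j + 1)))"
    by (simp add: partial_ratio_def a_def)
  also have "\<dots> = (1 - 2 * q) * (inverse a * a) * inverse (1 - q - q ^ (Suc j + 1)) *
      (inverse (1 - q ^ Suc j) * inverse (q_pochhammer q j))"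
    unfolding denominator_factorisation Suc fps_inverse_mult a_def by (simp only: mult_ac)
  finally show ?case
    by (simp only: a mult_1_right q_pochhammer_Suc fps_inverse_mult)
qed

text \<open>
  The numerator and denominator factors differ exactly by q^(2j+3) at index j + 1, so the terms of the
  denominator series are differences of consecutive ratios.
\<close>
lemma partial_ratio_telescopes:
  fixes q :: "'a::field fps"
  assumes q0: "q $ 0 = 0"
  shows "partial_ratio q j - partial_ratio q (Suc j) =
    q ^ (2 * Suc j + 1) * partial_ratio q j * inverse (1 - q - q ^ Suc j + q ^ (2 * Suc j + 1))"
proof -
  define a where "a = 1 - q - q ^ Suc j"
  define d where "d = 1 - q - q ^ Suc j + q ^ (2 * Suc j + 1)"
  have d: "d * inverse d = 1"
    by (intro inverse_mult_eq_1') (simp add: d_def q0)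
  have "partial_ratio q (Suc j) = partial_ratio q j * (a * inverse d)"
    by (simp add: partial_ratio_def a_def d_def)
  then have "partial_ratio q j - partial_ratio q (Suc j) =
      partial_ratio q j * (d * inverse d - a * inverse d)"
    by (simp add: d algebra_simps)
  also have "\<dots> = partial_ratio q j * ((d - a) * inverse d)"
    by (simp only: left_diff_distrib)
  also have "d - a = q ^ (2 * Suc j + 1)" by (simp add: d_def a_def)
  finally show ?thesis by (simp add: d_def mult_ac)
qed

text \<open>
  The stated quotient after cutting both series at J.  By the closed form,
  (1 - q) P_J agrees with (1 - 2q) / (q;q)_J modulo q^(J+1), which reduces the claim to
  \<open>q_series_transformation\<close>.
\<close>
lemma truncated_quotient_identity:
  fixes q :: "'a::field fps"
  assumes q0: "q $ 0 = 0"
  shows "q ^ (J + 1) dvd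
    (1 - q) * partial_ratio q J * (\<Sum>m = 1..J. (q * inverse (1 - q)) ^ m * q_pochhammer q m) -
    (\<Sum>j\<le>J. q ^ (2 * j + 1) * partial_ratio q j)"
proof -
  define F where "F = (\<Sum>m = 1..J. (q * inverse (1 - q)) ^ m * q_pochhammer q m)"
  define T where "T =
    (\<Sum>j\<le>J. q ^ (2 * j + 1) * inverse (1 - q - q ^ (j + 1)) * inverse (q_pochhammer q j))"
  define a where "a = 1 - q - q ^ (J + 1)"
  define p where "p = q_pochhammer q J"
  have a: "a * inverse a = 1"
    by (intro inverse_mult_eq_1') (simp add: a_def q0)
  have p: "p * inverse p = 1"
    unfolding p_def by (rule q_pochhammer_inverse[OF q0])
  have qa: "1 - q = a + q ^ (J + 1)" by (simp add: a_def)
  have "(1 - q) * partial_ratio q J = (1 - 2 * q) * ((1 - q) * inverse a) * inverse p"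
    unfolding partial_ratio_closed_form[OF q0] a_def p_def by (simp only: mult_ac)
  also have "(1 - q) * inverse a = 1 + q ^ (J + 1) * inverse a"
    unfolding qa distrib_right a ..
  finally have ratio: "(1 - q) * partial_ratio q J =
      (1 - 2 * q) * inverse p + q ^ (J + 1) * ((1 - 2 * q) * inverse a * inverse p)"
    by (simp add: algebra_simps)
  have rhs: "(\<Sum>j\<le>J. q ^ (2 * j + 1) * partial_ratio q j) = (1 - 2 * q) * T"
    unfolding T_def sum_distrib_left partial_ratio_closed_form[OF q0]
    by (intro sum.cong refl) (simp only: mult_ac)
  have expand: "c * inverse p * (F - p * T) = c * inverse p * F - c * T" for c
  proof -
    have "c * inverse p * (F - p * T) = c * inverse p * F - c * (p * inverse p) * T"
      by (simp add: algebra_simps)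
    then show ?thesis by (simp only: p mult_1_right)
  qed
  have "(1 - q) * partial_ratio q J * F - (1 - 2 * q) * T =
      (1 - 2 * q) * inverse p * (F - p * T) +
        q ^ (J + 1) * ((1 - 2 * q) * inverse a * inverse p * F)"
    unfolding ratio expand by (simp only: distrib_right mult.assoc) simp
  also have "q ^ (J + 1) dvd \<dots>"
    unfolding F_def p_def T_def
    by (intro dvd_add dvd_mult dvd_triv_left q_series_transformation[OF q0])
  finally show ?thesis
    by (simp only: F_def rhs)
qed

section \<open>The terms of the stated series in the variable q\<close>

lemma one_minus_run_var: "(1 - t) * (1 - run_var) = 1 - 2 * t"
  using one_minus_t_run_var by (simp add: right_diff_distrib)

lemma t_power_eq: "t ^ n = (1 - t) ^ n * run_var ^ n"
  by (simp only: power_mult_distrib[symmetric] one_minus_t_run_var)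

lemma numerator_factor_in_run_var:
  "(1 - 2 * t) * (1 - t) ^ i - (1 - t) * t ^ i = (1 - t) ^ (i + 1) * (1 - run_var - run_var ^ i)"
  unfolding one_minus_run_var[symmetric] t_power_eq by (simp add: algebra_simps)

lemma denominator_factor_in_run_var:
  "(1 - 2 * t) * (1 - t) ^ (2 * i) - t ^ i * (1 - t) ^ (i + 1) + t ^ (2 * i + 1) =
    (1 - t) ^ (2 * i + 1) * (1 - run_var - run_var ^ i + run_var ^ (2 * i + 1))"
proof -
  have "u * (1 - q) * u ^ (2 * i) - u ^ i * q ^ i * u ^ (i + 1) + u ^ (2 * i + 1) * q ^ (2 * i + 1) =
      u ^ (2 * i + 1) * (1 - q - q ^ i + q ^ (2 * i + 1))" for u q :: "rat fps"
  proof -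
    have "u ^ i * q ^ i * u ^ (i + 1) = u ^ (2 * i + 1) * q ^ i"
      by (simp add: mult_2 power_add)
    moreover have "u * (1 - q) * u ^ (2 * i) = u ^ (2 * i + 1) * (1 - q)"
      by simp
    ultimately show ?thesis by (simp only: right_diff_distrib distrib_left)
  qed
  then show ?thesis
    unfolding one_minus_run_var[symmetric] t_power_eq .
qed

lemma last_factor_in_run_var:
  "(1 - 2 * t) * (1 - t) ^ k - t ^ Suc k = (1 - t) ^ Suc k * (1 - run_var - run_var ^ Suc k)"
  unfolding one_minus_run_var[symmetric] t_power_eq by (simp add: algebra_simps)

lemma one_minus_t_powi: "(1 - t) powi (int m - 1) = (1 - t) ^ m * inverse (1 - t)"
proof (cases m)
  case 0
  then show ?thesis by (simp add: power_int_def)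
next
  case (Suc n)
  then show ?thesis
    using one_minus_t_inverse by (simp add: mult.assoc mult.left_commute)
qed

text \<open>
  The factors i carry (1 - t)^(i+1) above and (1 - t)^(2i+1) below, so the surplus powers add up
  to the triangular number j (j + 1) / 2.
\<close>
lemma products_in_run_var:
  defines "u \<equiv> 1 - t"
  shows "(\<Prod>i = 1..j. (1 - 2 * t) * (1 - t) ^ i - (1 - t) * t ^ i) *
      inverse (\<Prod>i = 1..j. (1 - 2 * t) * (1 - t) ^ (2 * i) - t ^ i * (1 - t) ^ (i + 1) + t ^ (2 * i + 1)) =
    inverse u ^ (j * (j + 1) div 2) * partial_ratio run_var j"
proof (induction j)
  case 0
  then show ?case by (simp add: partial_ratio_def)
next
  case (Suc j)
  have uv: "u ^ n * inverse u ^ n = 1" for n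
    unfolding u_def by (rule one_minus_t_power_inverse)
  define N where "N i = (1 - 2 * t) * (1 - t) ^ i - (1 - t) * t ^ i" for i
  define D where "D i = (1 - 2 * t) * (1 - t) ^ (2 * i) - t ^ i * (1 - t) ^ (i + 1) + t ^ (2 * i + 1)"
    for i
  let ?r = "(1 - run_var - run_var ^ Suc j) *
    inverse (1 - run_var - run_var ^ Suc j + run_var ^ (2 * Suc j + 1))"
  have "N (Suc j) * inverse (D (Suc j)) =
      u ^ (Suc j + 1) * inverse u ^ (2 * Suc j + 1) * ?r"
    unfolding N_def D_def numerator_factor_in_run_var denominator_factor_in_run_var u_def
      fps_inverse_mult fps_inverse_power
    by (simp only: mult_ac)
  also have "inverse u ^ (2 * Suc j + 1) = inverse u ^ (Suc j + 1) * inverse u ^ Suc j"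
    by (simp only: power_add[symmetric]) (simp add: mult_2)
  also have "u ^ (Suc j + 1) * (inverse u ^ (Suc j + 1) * inverse u ^ Suc j) = inverse u ^ Suc j"
    by (simp only: mult.assoc[symmetric] uv mult_1_left)
  finally have factor: "N (Suc j) * inverse (D (Suc j)) = inverse u ^ Suc j * ?r" .
  have exponent: "Suc j * (Suc j + 1) div 2 = j * (j + 1) div 2 + Suc j"
    by simp
  have "(\<Prod>i = 1..Suc j. N i) * inverse (\<Prod>i = 1..Suc j. D i) =
      ((\<Prod>i = 1..j. N i) * inverse (\<Prod>i = 1..j. D i)) * (N (Suc j) * inverse (D (Suc j)))"
    by (simp add: fps_inverse_mult mult_ac)
  also have "(\<Prod>i = 1..j. N i) * inverse (\<Prod>i = 1..j. D i) =
      inverse u ^ (j * (j + 1) div 2) * partial_ratio run_var j"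
    using Suc.IH by (simp only: N_def D_def)
  also have "inverse u ^ (j * (j + 1) div 2) * partial_ratio run_var j *
      (N (Suc j) * inverse (D (Suc j))) =
      inverse u ^ (j * (j + 1) div 2 + Suc j) * (partial_ratio run_var j * ?r)"
    unfolding factor by (simp only: power_add mult_ac)
  also have "partial_ratio run_var j * ?r = partial_ratio run_var (Suc j)"
    by (simp add: partial_ratio_def)
  finally show ?case
    by (simp only: N_def D_def exponent)
qed

lemma denominator_product_nth_0:
  "(\<Prod>i = 1..j. (1 - 2 * t) * (1 - t) ^ (2 * i) - t ^ i * (1 - t) ^ (i + 1) + t ^ (2 * i + 1)) $ 0
    = 1"
  by (induction j) (simp_all add: fps_power_zeroth)

lemma Suc_choose_two: "Suc k choose 2 = k + (k choose 2)"
  by (simp add: numeral_2_eq_2)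

text \<open>
  Powers of 1 - t in the numerator term of index k + 1.  On the left are those of
  t^(2k+3) = ((1 - t) q)^(2k+3) and of the binomial exponent; on the right those cancelled by the
  products and by the -1 in the exponent, and the one factor 1 - t that survives.
\<close>
lemma num_exponent: "2 * Suc k + 1 + (k choose 2) = Suc (Suc (Suc k * (Suc k + 1) div 2))"
proof (induction k)
  case 0
  then show ?case by simp
next
  case (Suc k)
  have "Suc (Suc k) * (Suc (Suc k) + 1) div 2 = Suc k * (Suc k + 1) div 2 + Suc (Suc k)"
    by simp
  moreover have "2 * Suc (Suc k) + 1 + (k + c) = Suc (Suc (e + Suc (Suc k)))"
    if "2 * Suc k + 1 + c = Suc (Suc e)" for c e
    using that by simp
  ultimately show ?case using Suc.IH by (simp only: Suc_choose_two)
qed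

lemma num_term_eq:
  "num_term (Suc k) = (1 - t) * run_var ^ (2 * Suc k + 1) * partial_ratio run_var (Suc k)"
proof -
  define u where "u = 1 - t"
  have uv: "u ^ n * inverse u ^ n = 1" for n
    unfolding u_def by (rule one_minus_t_power_inverse)
  define e where "e = Suc k * (Suc k + 1) div 2"
  have exponent: "2 * Suc k + 1 + (k choose 2) = Suc (Suc e)"
    unfolding e_def by (rule num_exponent)
  have "num_term (Suc k) = t ^ (2 * Suc k + 1) * (u ^ (k choose 2) * inverse u) *
      (inverse u ^ e * partial_ratio run_var (Suc k))"
    unfolding num_term_def e_def u_def products_in_run_var[symmetric]
    by (subst fps_divide_unit)
       (simp_all only: denominator_product_nth_0 one_minus_t_powi diff_Suc_1 mult.assoc one_neq_zero
         not_False_eq_True)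
  also have "\<dots> = u ^ (2 * Suc k + 1 + (k choose 2)) * inverse u ^ Suc e *
      run_var ^ (2 * Suc k + 1) * partial_ratio run_var (Suc k)"
    unfolding t_power_eq u_def by (simp only: power_add power_Suc mult_ac)
  also have "u ^ (2 * Suc k + 1 + (k choose 2)) * inverse u ^ Suc e = u * (u ^ Suc e * inverse u ^ Suc e)"
    unfolding exponent by (simp only: power_Suc mult.assoc)
  finally show ?thesis
    by (simp only: uv mult_1_right) (simp only: u_def)
qed

lemma den_term_eq:
  "den_term (Suc k) = (1 - 2 * t) * (partial_ratio run_var k - partial_ratio run_var (Suc k))"
proof -
  define u where "u = 1 - t"
  have uv: "u ^ n * inverse u ^ n = 1" for n
    unfolding u_def by (rule one_minus_t_power_inverse)
  define e where "e = Suc k * (Suc k + 1) div 2"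
  define a where "a = 1 - run_var - run_var ^ Suc k"
  define d where "d = 1 - run_var - run_var ^ Suc k + run_var ^ (2 * Suc k + 1)"
  have a: "a * inverse a = 1"
    by (intro inverse_mult_eq_1') (simp add: a_def run_var_nth_0)
  have ratio: "partial_ratio run_var (Suc k) = partial_ratio run_var k * (a * inverse d)"
    by (simp add: partial_ratio_def a_def d_def)
  have exponent: "2 * Suc k + 1 + (Suc k choose 2) = Suc (Suc k + e)"
    using num_exponent[of k] by (simp only: Suc_choose_two e_def)
  define L where "L = (1 - 2 * t) * (1 - t) ^ (Suc k - 1) - t ^ Suc k"
  have L: "inverse L = inverse u ^ Suc k * inverse a"
    unfolding L_def diff_Suc_1 last_factor_in_run_var u_def a_def
    by (simp only: fps_inverse_mult fps_inverse_power)
  have L0: "L $ 0 \<noteq> 0"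
    by (cases k) (simp_all add: L_def)
  have "den_term (Suc k) = t ^ (2 * Suc k + 1) * (1 - 2 * t) * (u ^ (Suc k choose 2) * inverse u) *
      (inverse u ^ e * partial_ratio run_var (Suc k)) * inverse L"
  proof -
    have "f / (L * g) = f * inverse g * inverse L" if "g $ 0 = 1" for f g
      using that L0 by (simp add: fps_divide_unit fps_inverse_mult mult_ac)
    from this[OF denominator_product_nth_0] show ?thesis
      unfolding den_term_def L_def[symmetric] e_def u_def products_in_run_var[symmetric]
        one_minus_t_powi by (simp only: mult.assoc)
  qed
  also have "\<dots> = (1 - 2 * t) * (u ^ (2 * Suc k + 1 + (Suc k choose 2)) * inverse u ^ Suc (Suc k + e)) *
      run_var ^ (2 * Suc k + 1) * partial_ratio run_var k * (a * inverse a) * inverse d"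
    unfolding t_power_eq u_def L[unfolded u_def] ratio by (simp only: power_add power_Suc mult_ac)
  also have "\<dots> = (1 - 2 * t) * (run_var ^ (2 * Suc k + 1) * partial_ratio run_var k * inverse d)"
    unfolding exponent uv a by (simp only: mult_1_right mult_1_left mult.assoc)
  finally show ?thesis
    by (simp only: partial_ratio_telescopes[OF run_var_nth_0] d_def)
qed

lemma t_power_dvd_run_var_power: "t ^ n dvd run_var ^ n"
  by (intro dvd_power_same) (simp add: run_var_def)

lemma t_power_dvd_num_term: "t ^ Suc k dvd num_term (Suc k)"
proof -
  have "t ^ Suc k dvd run_var ^ (2 * Suc k + 1)"
    by (rule dvd_trans[OF t_power_dvd_run_var_power le_imp_power_dvd]) simp
  then show ?thesis unfolding num_term_eq by (intro dvd_mult dvd_mult2)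
qed

lemma t_power_dvd_den_term: "t ^ Suc k dvd den_term (Suc k)"
proof -
  have "t ^ Suc k dvd run_var ^ (2 * Suc k + 1)"
    by (rule dvd_trans[OF t_power_dvd_run_var_power le_imp_power_dvd]) simp
  then show ?thesis
    unfolding den_term_eq partial_ratio_telescopes[OF run_var_nth_0]
    by (intro dvd_mult dvd_mult2)
qed

lemma num_partial_sum:
  "t + (\<Sum>k<J. num_term (Suc k)) =
    (1 - t) * (\<Sum>j\<le>J. run_var ^ (2 * j + 1) * partial_ratio run_var j)"
proof -
  have "(\<Sum>j\<le>J. run_var ^ (2 * j + 1) * partial_ratio run_var j) =
      run_var + (\<Sum>k<J. run_var ^ (2 * Suc k + 1) * partial_ratio run_var (Suc k))"
    unfolding lessThan_Suc_atMost[symmetric] sum.lessThan_Suc_shift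
    by (simp add: partial_ratio_def)
  then show ?thesis
    by (simp only: distrib_left one_minus_t_run_var sum_distrib_left num_term_eq mult.assoc)
qed

lemma den_partial_sum:
  "1 - 2 * t - (\<Sum>k<J. den_term (Suc k)) = (1 - 2 * t) * partial_ratio run_var J"
proof -
  have "(\<Sum>k<J. den_term (Suc k)) = (1 - 2 * t) * (1 - partial_ratio run_var J)"
    unfolding den_term_eq sum_distrib_left[symmetric] sum_lessThan_telescope'
    by (simp add: partial_ratio_def)
  then show ?thesis by (simp add: right_diff_distrib)
qed

section \<open>Convergence and the quotient formula\<close>

text \<open>
  The coefficient of index n only receives contributions from the terms with j \<le> n, so partial
  sums become stationary in each coefficient.
\<close>
lemma fps_series_converges:
  fixes f :: "nat \<Rightarrow> 'a::comm_ring_1 fps"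
  assumes "\<And>j. fps_X ^ j dvd f j"
  shows "summable f" and "fps_X ^ J dvd suminf f - (\<Sum>j<J. f j)"
proof -
  have zero: "f j $ n = 0" if "n < j" for j n
    using assms[of j] that by (simp add: fps_X_power_dvd_iff)
  define S where "S = Abs_fps (\<lambda>n. \<Sum>j\<le>n. f j $ n)"
  have partial: "(\<Sum>j<N. f j) $ n = S $ n" if "n < N" for N n
    unfolding S_def fps_sum_nth fps_nth_Abs_fps
    by (rule sum.mono_neutral_right) (use that zero in auto)
  have "f sums S"
    unfolding sums_def
  proof (rule tendsto_fpsI)
    fix n
    show "\<forall>\<^sub>F N in sequentially. (\<Sum>j<N. f j) $ n = S $ n"
      using eventually_gt_at_top[of n] by eventually_elim (rule partial)
  qed
  then show "summable f" and "fps_X ^ J dvd suminf f - (\<Sum>j<J. f j)"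
    by (auto simp: sums_iff fps_X_power_dvd_iff partial)
qed

theorem theorem3p2:
  shows "summable (\<lambda>j. num_term (Suc j)) \<and> summable (\<lambda>j. den_term (Suc j)) \<and>
    Abs_fps (\<lambda>n. if n \<ge> 1 then of_nat (catalan_avoid_count 2 1 2 n) else 0) =
      (t + (\<Sum>j. num_term (Suc j))) / (1 - 2 * t - (\<Sum>j. den_term (Suc j)))"
proof (intro conjI)
  have num_dvd: "t ^ j dvd num_term (Suc j)" and den_dvd: "t ^ j dvd den_term (Suc j)" for j
    by (rule dvd_trans[OF le_imp_power_dvd t_power_dvd_num_term]
          dvd_trans[OF le_imp_power_dvd t_power_dvd_den_term], simp)+
  show "summable (\<lambda>j. num_term (Suc j))" and "summable (\<lambda>j. den_term (Suc j))"
    by (intro fps_series_converges(1) num_dvd den_dvd)+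
  define N where "N = t + (\<Sum>j. num_term (Suc j))"
  define M where "M = 1 - 2 * t - (\<Sum>j. den_term (Suc j))"
  have congruence: "t ^ J dvd avoider_gf * M - N" if "1 \<le> J" for J
  proof -
    define P where "P = partial_ratio run_var J"
    define F where
      "F = (\<Sum>m = 1..J. (run_var * inverse (1 - run_var)) ^ m * q_pochhammer run_var m)"
    define T where "T = (\<Sum>j\<le>J. run_var ^ (2 * j + 1) * partial_ratio run_var j)"
    have "t ^ J dvd (\<Sum>j. den_term (Suc j)) - (\<Sum>j<J. den_term (Suc j))"
      by (intro fps_series_converges(2) den_dvd)
    then have M: "t ^ J dvd (1 - 2 * t) * P - M"
      unfolding M_def P_def den_partial_sum[symmetric] by simp
    have "t ^ J dvd (\<Sum>j. num_term (Suc j)) - (\<Sum>j<J. num_term (Suc j))"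
      by (intro fps_series_converges(2) num_dvd)
    then have N: "t ^ J dvd N - (1 - t) * T"
      unfolding N_def T_def num_partial_sum[symmetric] by simp
    have "t ^ J dvd t ^ (J + 1)" by simp
    then have F: "t ^ J dvd avoider_gf - F"
      unfolding F_def using avoider_gf_by_max_letter[OF that] by (rule dvd_trans)
    have "t ^ J dvd run_var ^ (J + 1)"
      by (rule dvd_trans[OF t_power_dvd_run_var_power le_imp_power_dvd]) simp
    then have T: "t ^ J dvd (1 - run_var) * P * F - T"
      unfolding P_def F_def T_def
      using truncated_quotient_identity[OF run_var_nth_0] by (rule dvd_trans)
    \<comment> \<open>Replace each of the three series by its truncation, one at a time.\<close>
    have "avoider_gf * M - N = (avoider_gf - F) * ((1 - 2 * t) * P)
        + (1 - t) * ((1 - run_var) * P * F - T)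
        - avoider_gf * ((1 - 2 * t) * P - M) - (N - (1 - t) * T)"
      unfolding one_minus_run_var[symmetric] by (simp add: algebra_simps)
    then show ?thesis
      using M N F T by (simp only: dvd_add dvd_diff dvd_mult dvd_mult2)
  qed
  have "(avoider_gf * M - N) $ n = 0" for n
    using congruence[of "Suc n"] unfolding fps_X_power_dvd_iff by auto
  then have equation: "avoider_gf * M = N"
    by (intro fps_ext) simp
  \<comment> \<open>A nonzero M suffices to divide, and its constant coefficient is 1.\<close>
  have "M \<noteq> 0"
  proof -
    have "t ^ 1 dvd (\<Sum>j. den_term (Suc j)) - (\<Sum>j<1. den_term (Suc j))"
      by (intro fps_series_converges(2) den_dvd)
    then have "(\<Sum>j. den_term (Suc j)) $ 0 = den_term (Suc 0) $ 0"
      unfolding fps_X_power_dvd_iff by simp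
    also have "\<dots> = 0"
      using t_power_dvd_den_term[of 0] unfolding fps_X_power_dvd_iff by simp
    finally have "M $ 0 = 1" by (simp add: M_def)
    then show ?thesis by auto
  qed
  then show "Abs_fps (\<lambda>n. if n \<ge> 1 then of_nat (catalan_avoid_count 2 1 2 n) else 0) =
      (t + (\<Sum>j. num_term (Suc j))) / (1 - 2 * t - (\<Sum>j. den_term (Suc j)))"
    unfolding N_def[symmetric] M_def[symmetric] equation[symmetric] avoider_gf_def by simp
qed

end
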